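(* Let $a,b,\theta\in\mathbb{N}$ with $2\leq\theta<a$ and $\theta<b$. Consider bootstrap percolation with threshold parameter $\theta$ and initial probability $p\in[0,1]$ on the $2$-periodic tree $\mathbb{T}_{a,b}$. There exists $p_f\in(0,1)$ such that for all $p>p_f$ the tree $\mathbb{T}_{a,b}$ is fully active asymptotically almost surely, and for all $p<p_f$ the tree $\mathbb{T}_{a,b}$ is not fully active asymptotically almost surely. That is, $\mathbb{P}_p(\mathbb{T}_{a,b}\text{ becomes fully active})=1$ for every $p>p_f$ and $\mathbb{P}_p(\mathbb{T}_{a,b}\text{ becomes fully active})=0$ for every $p<p_f$.
   Context: Periodic tree. $\mathbb{T}_{a,b}$ is the infinite tree with a distinguished node $\emptyset$ (the root) in which every node at even graph distance from $\emptyset$ has degree $a+1$ and every node at odd graph distance from $\emptyset$ has degree $b+1$ (so every edge joins a node of degree type $a$ to a node of degree type $b$). Bootstrap percolation on a graph $G=(V,E)$ with threshold parameter $\theta$ and initial probability $p$. At time $t=0$ each node is active (state $1$) with probability $p$ and inactive (state $0$) otherwise, independently over nodes; $\mathbb{P}_p$ denotes the resulting probability. At each discrete time step $t\to t+1$, an inactive node becomes active if at least $\theta$ of its neighbors are active at time $t$; active nodes remain active forever. "$G$ becomes fully active" is the event that every node of $G$ is active at some finite time (i.e. the limiting configuration as $t\to\infty$ has all nodes active). *)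

theory Defs
  imports "HOL-Probability.Probability" "HOL-Library.Sublist"
begin

section \<open>Bootstrap percolation on a locally finite graph\<close>

text \<open>
  A graph is given by its set of nodes \<open>V\<close> and its set of edges \<open>E\<close>, a symmetric irreflexive
  relation on \<open>V\<close>. The cardinality below counts correctly only for nodes of finite degree.
\<close>

primrec active_at :: "('v \<times> 'v) set \<Rightarrow> nat \<Rightarrow> ('v \<Rightarrow> bool) \<Rightarrow> nat \<Rightarrow> 'v \<Rightarrow> bool" where
  "active_at E \<theta> \<omega> 0 v \<longleftrightarrow> \<omega> v"
| "active_at E \<theta> \<omega> (Suc t) v \<longleftrightarrow>
     active_at E \<theta> \<omega> t v \<or> \<theta> \<le> card {u. (v, u) \<in> E \<and> active_at E \<theta> \<omega> t u}"

definition initial_measure :: "'v set \<Rightarrow> real \<Rightarrow> ('v \<Rightarrow> bool) measure" where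
  "initial_measure V p = Pi\<^sub>M V (\<lambda>_. measure_pmf (bernoulli_pmf p))"

definition becomes_fully_active ::
  "'v set \<Rightarrow> ('v \<times> 'v) set \<Rightarrow> nat \<Rightarrow> ('v \<Rightarrow> bool) \<Rightarrow> bool" where
  "becomes_fully_active V E \<theta> \<omega> \<longleftrightarrow> (\<forall>v\<in>V. \<exists>t. active_at E \<theta> \<omega> t v)"

definition fully_active_prob :: "'v set \<Rightarrow> ('v \<times> 'v) set \<Rightarrow> nat \<Rightarrow> real \<Rightarrow> real" where
  "fully_active_prob V E \<theta> p =
     measure (initial_measure V p)
       {\<omega> \<in> space (initial_measure V p). becomes_fully_active V E \<theta> \<omega>}"

section \<open>The periodic tree\<close>

text \<open>
  A node is the list of child indices on the way from the root \<open>[]\<close>, with the most recent index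
  at the head; thus the parent of \<open>i # v\<close> is \<open>v\<close>, and the length of a node is its distance from
  the root. The root has \<open>a + 1\<close> children; every other node has one child fewer than its degree.
\<close>

definition num_children :: "nat \<Rightarrow> nat \<Rightarrow> nat list \<Rightarrow> nat" where
  "num_children a b v = (if v = [] then a + 1 else if even (length v) then a else b)"

inductive_set tree_nodes :: "nat \<Rightarrow> nat \<Rightarrow> nat list set" for a b :: nat where
  root: "[] \<in> tree_nodes a b"
| child: "v \<in> tree_nodes a b \<Longrightarrow> i < num_children a b v \<Longrightarrow> i # v \<in> tree_nodes a b"

definition tree_edges :: "nat \<Rightarrow> nat \<Rightarrow> (nat list \<times> nat list) set" where
  "tree_edges a b =
     {(u, v). u \<in> tree_nodes a b \<and> v \<in> tree_nodes a b \<and> (\<exists>i. v = i # u \<or> u = i # v)}"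

section \<open>The tree has the defining properties\<close>

lemma Cons_in_tree_nodes_iff:
  "i # v \<in> tree_nodes a b \<longleftrightarrow> v \<in> tree_nodes a b \<and> i < num_children a b v"
  by (auto intro: tree_nodes.child elim: tree_nodes.cases)

lemma sym_tree_edges: "sym (tree_edges a b)"
  by (auto simp: tree_edges_def sym_def)

lemma irrefl_tree_edges: "irrefl (tree_edges a b)"
  by (auto simp: tree_edges_def irrefl_def)

lemma tree_neighbours_root:
  "{u. ([], u) \<in> tree_edges a b} = (\<lambda>i. [i]) ` {..<a + 1}"
  by (auto simp: tree_edges_def Cons_in_tree_nodes_iff num_children_def tree_nodes.root)

lemma tree_neighbours_Cons:
  assumes "j # v \<in> tree_nodes a b"
  shows "{u. (j # v, u) \<in> tree_edges a b} =
           insert v ((\<lambda>i. i # j # v) ` {..<num_children a b (j # v)})"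
  using assms by (auto simp: tree_edges_def Cons_in_tree_nodes_iff)

lemma tree_degree:
  assumes "v \<in> tree_nodes a b"
  shows "finite {u. (v, u) \<in> tree_edges a b}"
    and "card {u. (v, u) \<in> tree_edges a b} = (if even (length v) then a + 1 else b + 1)"
proof -
  have "finite {u. (v, u) \<in> tree_edges a b} \<and>
        card {u. (v, u) \<in> tree_edges a b} = (if even (length v) then a + 1 else b + 1)"
  proof (cases v)
    case Nil
    have "card ((\<lambda>i. [i]) ` {..<a + 1}) = a + 1"
      by (subst card_image) (auto simp: inj_on_def)
    then show ?thesis using Nil by (simp add: tree_neighbours_root)
  next
    case (Cons j w)
    let ?C = "(\<lambda>i. i # j # w) ` {..<num_children a b (j # w)}"
    have 1: "card ?C = num_children a b (j # w)"
      by (subst card_image) (auto simp: inj_on_def)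
    have "w \<notin> ?C"
    proof
      assume "w \<in> ?C"
      then obtain i where "w = i # j # w" by blast
      then have "length w = length (i # j # w)" by simp
      then show False by simp
    qed
    then have "card (insert w ?C) = Suc (num_children a b (j # w))"
      using 1 by simp
    then show ?thesis
      using Cons assms tree_neighbours_Cons[of j w a b] by (simp add: num_children_def)
  qed
  then show "finite {u. (v, u) \<in> tree_edges a b}"
    and "card {u. (v, u) \<in> tree_edges a b} = (if even (length v) then a + 1 else b + 1)"
    by auto
qed

lemma tree_path_from_root:
  assumes "v \<in> tree_nodes a b"
  shows "([], v) \<in> tree_edges a b ^^ length v"
  using assms
proof (induction rule: tree_nodes.induct)
  case (child v i)
  have "(v, i # v) \<in> tree_edges a b"
    using child.hyps by (auto simp: tree_edges_def intro: tree_nodes.child)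
  with child.IH show ?case by auto
qed simp

lemma tree_path_length:
  assumes "([], v) \<in> tree_edges a b ^^ n"
  shows "length v \<le> n"
  using assms
proof (induction n arbitrary: v)
  case (Suc n)
  then obtain u where u: "([], u) \<in> tree_edges a b ^^ n" "(u, v) \<in> tree_edges a b"
    by auto
  from u(2) have "length v \<le> Suc (length u)"
    by (auto simp: tree_edges_def)
  with Suc.IH[OF u(1)] show ?case by simp
qed simp

lemma tree_distance_root:
  assumes "v \<in> tree_nodes a b"
  shows "(LEAST n. ([], v) \<in> tree_edges a b ^^ n) = length v"
  using tree_path_from_root[OF assms] tree_path_length by (rule Least_equality)

lemma tree_connected:
  assumes "u \<in> tree_nodes a b" "v \<in> tree_nodes a b"
  shows "(u, v) \<in> (tree_edges a b)\<^sup>*"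
proof -
  have "([], w) \<in> (tree_edges a b)\<^sup>*" if "w \<in> tree_nodes a b" for w
    using tree_path_from_root[OF that] by (rule relpow_imp_rtrancl)
  with assms sym_rtrancl[OF sym_tree_edges] show ?thesis
    by (meson rtrancl_trans symD)
qed

text \<open>Acyclicity: every edge is a bridge.\<close>

lemma tree_edge_bridge:
  assumes "(u, v) \<in> tree_edges a b"
  shows "(u, v) \<notin> (tree_edges a b - {(u, v), (v, u)})\<^sup>*"
proof -
  have below: "suffix (i # w) y"
    if "(i # w, y) \<in> (tree_edges a b - {(i # w, w), (w, i # w)})\<^sup>*" for i w y
    using that
  proof (induction rule: rtrancl_induct)
    case (step y z)
    from step.hyps(2) consider j where "z = j # y" | j where "y = j # z"
      by (auto simp: tree_edges_def)
    then show ?case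
    proof cases
      case 1
      with step.IH show ?thesis by (simp add: suffix_ConsI)
    next
      case 2
      with step.IH step.hyps(2) show ?thesis by (auto simp: suffix_Cons)
    qed
  qed simp
  have no: "(i # w, w) \<notin> (tree_edges a b - {(i # w, w), (w, i # w)})\<^sup>*" for i w
    using suffix_length_le[of "i # w" w] below[of i w w] by auto
  have symd: "sym ((tree_edges a b - {(x, y), (y, x)})\<^sup>*)" for x y
    by (rule sym_rtrancl) (use sym_tree_edges[of a b] in \<open>auto simp: sym_def\<close>)
  from assms consider i where "v = i # u" | i where "u = i # v"
    by (auto simp: tree_edges_def)
  then show ?thesis
  proof cases
    case 1
    show ?thesis
    proof
      assume "(u, v) \<in> (tree_edges a b - {(u, v), (v, u)})\<^sup>*"
      then have "(v, u) \<in> (tree_edges a b - {(u, v), (v, u)})\<^sup>*"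
        using symd by (meson symD)
      with no[of i u] 1 show False by (simp add: insert_commute)
    qed
  next
    case 2
    with no[of i v] show ?thesis by simp
  qed
qed

section \<open>The event is measurable\<close>

lemma prob_space_initial_measure: "prob_space (initial_measure V p)"
  unfolding initial_measure_def by (intro prob_space_PiM measure_pmf.prob_space_axioms)

lemma measurable_active_at:
  assumes E: "E \<subseteq> V \<times> V" and fin: "\<And>v. v \<in> V \<Longrightarrow> finite {u. (v, u) \<in> E}" and "v \<in> V"
  shows "Measurable.pred (initial_measure V p) (\<lambda>\<omega>. active_at E \<theta> \<omega> t v)"
  using \<open>v \<in> V\<close>
proof (induction t arbitrary: v)
  case 0
  have "(\<lambda>\<omega>. \<omega> v) \<in> measurable (initial_measure V p) (measure_pmf (bernoulli_pmf p))"
    unfolding initial_measure_def using 0 by (rule measurable_component_singleton)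
  then show ?case by (simp add: measurable_def)
next
  case (Suc t)
  let ?N = "{u. (v, u) \<in> E}"
  have N: "?N \<subseteq> V" using E by auto
  have eq: "\<theta> \<le> card {u. (v, u) \<in> E \<and> active_at E \<theta> \<omega> t u} \<longleftrightarrow>
            (\<exists>S\<in>{S. S \<subseteq> ?N \<and> \<theta> \<le> card S}. \<forall>u\<in>S. active_at E \<theta> \<omega> t u)" for \<omega>
  proof
    assume "\<theta> \<le> card {u. (v, u) \<in> E \<and> active_at E \<theta> \<omega> t u}"
    then show "\<exists>S\<in>{S. S \<subseteq> ?N \<and> \<theta> \<le> card S}. \<forall>u\<in>S. active_at E \<theta> \<omega> t u"
      by (intro bexI[of _ "{u. (v, u) \<in> E \<and> active_at E \<theta> \<omega> t u}"]) auto
  next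
    assume "\<exists>S\<in>{S. S \<subseteq> ?N \<and> \<theta> \<le> card S}. \<forall>u\<in>S. active_at E \<theta> \<omega> t u"
    then obtain S where S: "S \<subseteq> {u. (v, u) \<in> E \<and> active_at E \<theta> \<omega> t u}" "\<theta> \<le> card S"
      by auto
    have "finite {u. (v, u) \<in> E \<and> active_at E \<theta> \<omega> t u}"
      by (rule finite_subset[OF _ fin[OF Suc.prems]]) auto
    with S show "\<theta> \<le> card {u. (v, u) \<in> E \<and> active_at E \<theta> \<omega> t u}"
      using card_mono le_trans by blast
  qed
  have "finite {S. S \<subseteq> ?N \<and> \<theta> \<le> card S}"
    using fin[OF Suc.prems] by simp
  moreover have "finite S" if "S \<subseteq> ?N" for S
    using that fin[OF Suc.prems] by (rule finite_subset)
  ultimately have "Measurable.pred (initial_measure V p)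
      (\<lambda>\<omega>. \<exists>S\<in>{S. S \<subseteq> ?N \<and> \<theta> \<le> card S}. \<forall>u\<in>S. active_at E \<theta> \<omega> t u)"
    using N Suc.IH by (intro pred_intros_finite) auto
  then show ?case
    unfolding active_at.simps eq using Suc.IH[OF Suc.prems] by (intro pred_intros_logic)
qed

lemma measurable_becomes_fully_active:
  fixes V :: "'v::countable set"
  assumes "E \<subseteq> V \<times> V" "\<And>v. v \<in> V \<Longrightarrow> finite {u. (v, u) \<in> E}"
  shows "Measurable.pred (initial_measure V p) (becomes_fully_active V E \<theta>)"
proof -
  have "Measurable.pred (initial_measure V p) (\<lambda>\<omega>. \<exists>t. active_at E \<theta> \<omega> t v)" if "v \<in> V" for v
    using measurable_active_at[OF assms(1,2) that] by (intro pred_intros_countable)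
  then show ?thesis
    unfolding becomes_fully_active_def[abs_def]
    by (intro pred_intros_countable_bounded)
qed

corollary sets_tree_becomes_fully_active:
  "{\<omega> \<in> space (initial_measure (tree_nodes a b) p).
      becomes_fully_active (tree_nodes a b) (tree_edges a b) \<theta> \<omega>}
   \<in> sets (initial_measure (tree_nodes a b) p)"
proof -
  have "tree_edges a b \<subseteq> tree_nodes a b \<times> tree_nodes a b"
    by (auto simp: tree_edges_def)
  then show ?thesis
    using measurable_becomes_fully_active[where E = "tree_edges a b" and V = "tree_nodes a b"
        and p = p and \<theta> = \<theta>] tree_degree(1)
    by (simp add: pred_def)
qed

end

theory Submission
  imports Defs
begin

text \<open>
  Keep the parent of a non-root node inactive and let the activation spread upwards from its
  descendants only. The probability that the node survives \<open>n\<close> rounds obeys a two-type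
  branching recursion; it decreases in \<open>n\<close> and in \<open>p\<close>, stays above \<open>1 - 2 * p\<close> for small \<open>p\<close>,
  and tends to \<open>0\<close> for \<open>p\<close> close to \<open>1\<close>. The threshold is the supremum of those \<open>p\<close> for which
  the limits are positive. If the limits are \<open>0\<close>, almost surely every non-root node is
  activated from below. If they are positive, an inactive node all of whose children survive
  forever occurs with probability bounded away from \<open>0\<close>, independently in infinitely many
  disjoint subtrees, and such a node never becomes active. Independence of disjoint subtrees thus
  replaces an ergodic zero-one law.
\<close>

section \<open>Counting independent events\<close>

text \<open>
  \<open>binomial_below c k q\<close> is the probability that fewer than \<open>k\<close> of \<open>c\<close> independent events of
  probability \<open>q\<close> occur. In the case \<open>k = 0\<close> the truncated \<open>k - 1\<close> is harmless.
\<close>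

primrec binomial_below :: "nat \<Rightarrow> nat \<Rightarrow> real \<Rightarrow> real" where
  "binomial_below 0 k q = (if k = 0 then 0 else 1)"
| "binomial_below (Suc c) k q = q * binomial_below c (k - 1) q + (1 - q) * binomial_below c k q"

section \<open>Estimates for the lower binomial tail\<close>

lemma binomial_below_0 [simp]: "binomial_below c 0 q = 0"
  by (induction c) auto

lemma binomial_below_1: "binomial_below c 1 q = (1 - q) ^ c"
  by (induction c) auto

lemma binomial_below_bounds:
  assumes "0 \<le> q" "q \<le> 1"
  shows "0 \<le> binomial_below c k q \<and> binomial_below c k q \<le> 1"
proof (induction c arbitrary: k)
  case (Suc c)
  have "q * binomial_below c (k - 1) q + (1 - q) * binomial_below c k q \<le> q * 1 + (1 - q) * 1"
    using assms Suc by (intro add_mono mult_left_mono) auto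
  with assms Suc show ?case by simp
qed simp

lemma binomial_below_mono:
  assumes "0 \<le> q" "q \<le> 1" "k \<le> l"
  shows "binomial_below c k q \<le> binomial_below c l q"
  using assms(3)
proof (induction c arbitrary: k l)
  case (Suc c)
  then show ?case
    unfolding binomial_below.simps using assms(1,2) by (intro add_mono mult_left_mono) auto
qed simp

text \<open>Replacing \<open>q\<close> by \<open>r\<close> for a single event moves weight
  \<open>r - q\<close> from the tail at \<open>k\<close> to the smaller tail at
  \<open>k - 1\<close>; the remaining events are covered by induction.\<close>

lemma binomial_below_antimono:
  assumes "0 \<le> q" "q \<le> r" "r \<le> 1"
  shows "binomial_below c k r \<le> binomial_below c k q"
proof (induction c arbitrary: k)
  case (Suc c)
  let ?G = "\<lambda>k. binomial_below c k r"
  have "0 \<le> (r - q) * (?G k - ?G (k - 1))"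
    using assms binomial_below_mono[of r "k - 1" k c] by (intro mult_nonneg_nonneg) auto
  then have "binomial_below (Suc c) k r \<le> q * ?G (k - 1) + (1 - q) * ?G k"
    by (simp add: algebra_simps)
  also have "\<dots> \<le> binomial_below (Suc c) k q"
    unfolding binomial_below.simps using assms Suc by (intro add_mono mult_left_mono) auto
  finally show ?case .
qed simp

text \<open>Union bound: as \<open>k \<le> c\<close>, fewer than \<open>k\<close> occurrences force
  at least one of the \<open>c\<close> events to fail.\<close>

lemma binomial_below_le:
  assumes "0 \<le> q" "q \<le> 1" "k \<le> c"
  shows "binomial_below c k q \<le> real c * (1 - q)"
  using assms(3)
proof (induction c arbitrary: k)
  case (Suc c)
  have "binomial_below c (k - 1) q \<le> real c * (1 - q)"
    using Suc by auto
  then have "q * binomial_below c (k - 1) q \<le> 1 * (real c * (1 - q))"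
    using assms(1,2) binomial_below_bounds[OF assms(1,2)] by (intro mult_mono) auto
  moreover have "(1 - q) * binomial_below c k q \<le> (1 - q) * 1"
    using assms(1,2) binomial_below_bounds[OF assms(1,2)] by (intro mult_left_mono) auto
  ultimately show ?case by (simp add: algebra_simps)
qed auto

text \<open>Two or more occurrences require some pair of events to occur together, which costs
  \<open>q\<^sup>2\<close>. The quadratic order is what makes the bound for small \<open>p\<close>
  in \<open>survival_ge\<close> close up.\<close>

lemma binomial_below_ge:
  assumes "0 \<le> q" "q \<le> 1" "2 \<le> k"
  shows "1 - (real c)\<^sup>2 * q\<^sup>2 \<le> binomial_below c k q"
proof -
  have "1 - (real c)\<^sup>2 * q\<^sup>2 \<le> binomial_below c 2 q"
  proof (induction c)
    case (Suc c)
    have "1 + real c * (- q) \<le> (1 + (- q)) ^ c"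
      using assms by (intro Bernoulli_inequality) auto
    then have "q * (1 - real c * q) \<le> q * binomial_below c 1 q"
      unfolding binomial_below_1 using assms by (intro mult_left_mono) auto
    moreover have "(1 - q) * (1 - (real c)\<^sup>2 * q\<^sup>2) \<le> (1 - q) * binomial_below c 2 q"
      using Suc assms by (intro mult_left_mono) auto
    moreover have "0 \<le> real (Suc c) * q\<^sup>2 + (real c)\<^sup>2 * q ^ 3"
      using assms by (intro add_nonneg_nonneg mult_nonneg_nonneg) auto
    moreover have "q * (1 - real c * q) + (1 - q) * (1 - (real c)\<^sup>2 * q\<^sup>2) =
        1 - (real (Suc c))\<^sup>2 * q\<^sup>2 + (real (Suc c) * q\<^sup>2 + (real c)\<^sup>2 * q ^ 3)"
      by (simp add: algebra_simps power2_eq_square power3_eq_cube)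
    ultimately show ?case by simp
  qed simp
  also have "\<dots> \<le> binomial_below c k q"
    using assms by (intro binomial_below_mono)
  finally show ?thesis .
qed

text \<open>The set \<open>J\<close> of events with prescribed outcomes strengthens the induction:
  splitting by the outcome of one event moves its index from \<open>I\<close> to
  \<open>J\<close>.\<close>

lemma (in prob_space) prob_card_less:
  fixes Z :: "'i \<Rightarrow> 'a \<Rightarrow> bool"
  assumes ind: "indep_vars (\<lambda>_. count_space UNIV) Z (I \<union> J)"
    and "finite I" "finite J" "I \<inter> J = {}"
    and q: "\<And>i. i \<in> I \<Longrightarrow> prob {\<omega> \<in> space M. Z i \<omega>} = q"
  shows "prob {\<omega> \<in> space M. (\<forall>j\<in>J. Z j \<omega> = s j) \<and> card {i \<in> I. Z i \<omega>} < k} =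
    (\<Prod>j\<in>J. prob {\<omega> \<in> space M. Z j \<omega> = s j}) * binomial_below (card I) k q"
  using \<open>finite I\<close> ind \<open>finite J\<close> \<open>I \<inter> J = {}\<close> q
proof (induction I arbitrary: J s k rule: finite_induct)
  case empty
  show ?case
  \<comment> \<open>The product formula used in the other case wants a nonempty index set, and for
    \<open>k = 0\<close> the event is empty.\<close>
  proof (cases "k = 0 \<or> J = {}")
    case True
    then show ?thesis using prob_space by auto
  next
    case False
    have eq: "Z j -` {s j} \<inter> space M = {\<omega> \<in> space M. Z j \<omega> = s j}" for j by auto
    have "{\<omega> \<in> space M. (\<forall>j\<in>J. Z j \<omega> = s j) \<and> card {i \<in> {}. Z i \<omega>} < k}
      = (\<Inter>j\<in>J. Z j -` {s j} \<inter> space M)"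
      using False by auto
    with indep_varsD_finite[OF empty(1)[simplified], of "\<lambda>j. {s j}"] False empty(2)
    show ?thesis by (simp add: eq)
  qed
next
  case (insert x I)
  have rv: "random_variable (count_space UNIV) (Z i)" if "i \<in> insert x I \<union> J" for i
    using insert.prems(1) that unfolding indep_vars_def by auto
  have ev: "{\<omega> \<in> space M. Z i \<omega> = c} \<in> events" if "i \<in> insert x I \<union> J" for i c
    using measurable_sets[OF rv[OF that], of "{c}"] by (simp add: vimage_def Int_def conj_commute)
  have x: "x \<notin> J" using insert.prems by auto
  have IH: "prob {\<omega> \<in> space M. (\<forall>j\<in>insert x J. Z j \<omega> = (s(x := c)) j) \<and> card {i \<in> I. Z i \<omega>} < l} =
      (\<Prod>j\<in>insert x J. prob {\<omega> \<in> space M. Z j \<omega> = (s(x := c)) j}) * binomial_below (card I) l q" for c l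
    using insert.prems insert.hyps by (intro insert.IH) auto
  let ?A = "\<lambda>c l. {\<omega> \<in> space M. (\<forall>j\<in>insert x J. Z j \<omega> = (s(x := c)) j) \<and> card {i \<in> I. Z i \<omega>} < l}"
  have card: "card {i \<in> insert x I. Z i \<omega>} = (if Z x \<omega> then Suc (card {i \<in> I. Z i \<omega>}) else card {i \<in> I. Z i \<omega>})" for \<omega>
  proof -
    have "{i \<in> insert x I. Z i \<omega>} = (if Z x \<omega> then insert x {i \<in> I. Z i \<omega>} else {i \<in> I. Z i \<omega>})"
      by auto
    then show ?thesis using insert.hyps by auto
  qed
  have meas: "?A c l \<in> events" for c l
  proof -
    have "{\<omega> \<in> space M. \<forall>j\<in>insert x J. Z j \<omega> = (s(x := c)) j} \<in> events"
      using ev \<open>finite J\<close> insert.prems by (intro sets.sets_Collect_finite_All) auto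
    moreover have "{\<omega> \<in> space M. card {i \<in> I. Z i \<omega>} < l} \<in> events"
    proof -
      have "{\<omega> \<in> space M. {i \<in> I. Z i \<omega>} = S} \<in> events" for S
      proof (cases "S \<subseteq> I")
        case True
        then have "{\<omega> \<in> space M. {i \<in> I. Z i \<omega>} = S} = {\<omega> \<in> space M. \<forall>i\<in>I. Z i \<omega> = (i \<in> S)}"
          by auto
        also have "\<dots> \<in> events"
          using ev insert.hyps by (intro sets.sets_Collect_finite_All) auto
        finally show ?thesis .
      next
        case False
        then have "{\<omega> \<in> space M. {i \<in> I. Z i \<omega>} = S} = {}" by auto
        then show ?thesis by (simp only: sets.empty_sets)
      qed
      then have "{\<omega> \<in> space M. \<exists>S\<in>{S. S \<subseteq> I \<and> card S < l}. {i \<in> I. Z i \<omega>} = S} \<in> events"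
        using insert.hyps by (intro sets.sets_Collect_finite_Ex) auto
      moreover have "{\<omega> \<in> space M. \<exists>S\<in>{S. S \<subseteq> I \<and> card S < l}. {i \<in> I. Z i \<omega>} = S}
         = {\<omega> \<in> space M. card {i \<in> I. Z i \<omega>} < l}"
        by auto
      ultimately show ?thesis by simp
    qed
    from sets.sets_Collect_conj[OF this calculation] show ?thesis
      by (simp only: conj_commute)
  qed
  \<comment> \<open>If event \<open>x\<close> occurs, fewer than \<open>k - 1\<close> others may
    occur. For \<open>k = 0\<close> both pieces are empty, so truncated subtraction does no
    harm.\<close>
  have eq: "{\<omega> \<in> space M. (\<forall>j\<in>J. Z j \<omega> = s j) \<and> card {i \<in> insert x I. Z i \<omega>} < k} =
      ?A True (k - 1) \<union> ?A False k"
    unfolding card using x by auto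
  let ?P = "\<Prod>j\<in>J. prob {\<omega> \<in> space M. Z j \<omega> = s j}"
  have px: "prob {\<omega> \<in> space M. Z x \<omega>} = q" using insert.prems by auto
  have "prob {\<omega> \<in> space M. \<not> Z x \<omega>} = 1 - q"
    using prob_neg[of "\<lambda>\<omega>. Z x \<omega>"] ev[of x True] px by simp
  moreover have "(\<Prod>j\<in>J. prob {\<omega> \<in> space M. Z j \<omega> = (s(x := c)) j}) = (\<Prod>j\<in>J. prob {\<omega> \<in> space M. Z j \<omega> = s j})" for c
    using x by (intro prod.cong) auto
  ultimately have "prob (?A True (k - 1)) = q * ?P * binomial_below (card I) (k - 1) q"
    and "prob (?A False k) = (1 - q) * ?P * binomial_below (card I) k q"
    unfolding IH using \<open>finite J\<close> x px by simp_all
  moreover have "prob (?A True (k - 1) \<union> ?A False k) = prob (?A True (k - 1)) + prob (?A False k)"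
    by (intro finite_measure_Union meas) auto
  ultimately show ?case
    unfolding eq using insert.hyps by (simp add: algebra_simps)
qed

section \<open>The recursion for the survival probability\<close>

text \<open>
  \<open>survival \<theta> p a b n\<close> is the probability that a node with \<open>a\<close> children, each of which has
  \<open>b\<close> children, and so on alternatingly, is not activated from below within \<open>n\<close> rounds.
\<close>

primrec survival :: "nat \<Rightarrow> real \<Rightarrow> nat \<Rightarrow> nat \<Rightarrow> nat \<Rightarrow> real" where
  "survival \<theta> p a b 0 = 1"
| "survival \<theta> p a b (Suc n) = (1 - p) * binomial_below a \<theta> (1 - survival \<theta> p b a n)"

section \<open>Monotonicity and bounds of the two-type recursion\<close>

lemma survival_bounds:
  assumes "0 \<le> p" "p \<le> 1"
  shows "0 \<le> survival \<theta> p a b n \<and> survival \<theta> p a b n \<le> 1"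
proof (induction n arbitrary: a b)
  case (Suc n)
  then have "0 \<le> binomial_below a \<theta> (1 - survival \<theta> p b a n) \<and>
      binomial_below a \<theta> (1 - survival \<theta> p b a n) \<le> 1"
    by (intro binomial_below_bounds) auto
  with assms show ?case by (simp add: mult_le_one)
qed simp

lemma survival_antimono:
  assumes "0 \<le> p" "p \<le> r" "r \<le> 1"
  shows "survival \<theta> r a b n \<le> survival \<theta> p a b n"
proof (induction n arbitrary: a b)
  case (Suc n)
  show ?case
    unfolding survival.simps using assms Suc survival_bounds[of r] survival_bounds[of p]
    by (intro mult_mono binomial_below_antimono conjunct1[OF binomial_below_bounds]) auto
qed simp

text \<open>Iterating a monotone map from the top value \<open>1\<close> gives a decreasing
  sequence.\<close>

lemma survival_Suc_le_self:
  assumes "0 \<le> p" "p \<le> 1"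
  shows "survival \<theta> p a b (Suc n) \<le> survival \<theta> p a b n"
proof (induction n arbitrary: a b)
  case 0
  show ?case using survival_bounds[OF assms, of \<theta> a b "Suc 0"] by simp
next
  case (Suc n)
  have "(1 - p) * binomial_below a \<theta> (1 - survival \<theta> p b a (Suc n))
     \<le> (1 - p) * binomial_below a \<theta> (1 - survival \<theta> p b a n)"
    using assms Suc survival_bounds[OF assms]
    by (intro mult_left_mono binomial_below_antimono) (auto simp del: survival.simps)
  then show ?case by simp
qed

text \<open>This linear estimate yields geometric decay for \<open>p\<close> near \<open>1\<close>
  and carries smallness from one type to the other.\<close>

lemma survival_Suc_le:
  assumes "0 \<le> p" "p \<le> 1" "\<theta> \<le> a"
  shows "survival \<theta> p a b (Suc n) \<le> (1 - p) * (real a * survival \<theta> p b a n)"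
proof -
  have "binomial_below a \<theta> (1 - survival \<theta> p b a n) \<le> real a * (1 - (1 - survival \<theta> p b a n))"
    using survival_bounds[OF assms(1,2)] assms(3) by (intro binomial_below_le) auto
  with assms show ?thesis by (simp add: mult_left_mono)
qed

text \<open>The bound \<open>2 * p\<close> on the activation probability reproduces itself: pairs of
  active children contribute at most \<open>(real m)\<^sup>2 * (2 * p)\<^sup>2 \<le> p\<close>, and
  \<open>(1 - p)\<^sup>2 \<ge> 1 - 2 * p\<close>. A common \<open>m\<close> serves both types, which
  alternate.\<close>

lemma survival_ge:
  assumes "0 \<le> p" "2 \<le> \<theta>" "a \<le> m" "b \<le> m" "4 * p * (real m)\<^sup>2 \<le> 1" "p \<le> 1"
  shows "1 - 2 * p \<le> survival \<theta> p a b n"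
  using assms(3,4)
proof (induction n arbitrary: a b)
  case 0
  then show ?case using assms by simp
next
  case (Suc n)
  let ?q = "1 - survival \<theta> p b a n"
  have q: "0 \<le> ?q" "?q \<le> 1" "?q \<le> 2 * p"
    using survival_bounds[OF \<open>0 \<le> p\<close> \<open>p \<le> 1\<close>, of \<theta> b a n] Suc.IH[of b a] Suc.prems by auto
  have "(real a)\<^sup>2 * ?q\<^sup>2 \<le> (real m)\<^sup>2 * (2 * p)\<^sup>2"
    using q Suc.prems assms by (intro mult_mono power_mono) auto
  also have "\<dots> = p * (4 * p * (real m)\<^sup>2)"
    by (simp add: power2_eq_square)
  also have "\<dots> \<le> p * 1"
    using assms by (intro mult_left_mono) auto
  finally have "1 - p \<le> binomial_below a \<theta> ?q"
    using binomial_below_ge[OF q(1,2) \<open>2 \<le> \<theta>\<close>, of a] by simp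
  then have "(1 - p) * (1 - p) \<le> (1 - p) * binomial_below a \<theta> ?q"
    using assms by (intro mult_left_mono) auto
  moreover have "(1 - p) * (1 - p) = 1 - 2 * p + p * p"
    by (simp add: algebra_simps)
  moreover have "0 \<le> p * p" by simp
  ultimately show ?case unfolding survival.simps by linarith
qed

lemma survival_le:
  assumes "0 \<le> p" "p \<le> 1" "\<theta> \<le> a" "\<theta> \<le> b" "a \<le> m" "b \<le> m" "(1 - p) * real m \<le> 1 / 2"
  shows "survival \<theta> p a b n \<le> (1 / 2) ^ n"
  using assms(3-6)
proof (induction n arbitrary: a b)
  case (Suc n)
  have "survival \<theta> p a b (Suc n) \<le> (1 - p) * real a * survival \<theta> p b a n"
    using survival_Suc_le[of p \<theta> a b n] assms Suc.prems by simp
  also have "\<dots> \<le> (1 - p) * real m * survival \<theta> p b a n"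
    using assms Suc.prems survival_bounds[OF assms(1,2)]
    by (intro mult_right_mono mult_left_mono) auto
  also have "\<dots> \<le> 1 / 2 * (1 / 2) ^ n"
    using assms Suc.prems Suc.IH[of b a] survival_bounds[OF assms(1,2)] by (intro mult_mono) auto
  finally show ?case by simp
qed simp

text \<open>For \<open>p\<close> in the unit interval both sequences decrease, so a common positive
  lower bound amounts to both limits being positive.\<close>

definition survives :: "nat \<Rightarrow> real \<Rightarrow> nat \<Rightarrow> nat \<Rightarrow> bool" where
  "survives \<theta> p a b \<longleftrightarrow> (\<exists>\<epsilon>>0. \<forall>n. \<epsilon> \<le> survival \<theta> p a b n \<and> \<epsilon> \<le> survival \<theta> p b a n)"

text \<open>Negating \<open>survives\<close> makes only one of the two sequences small. The linear
  estimate passes this to the other type one round later, at the cost of a factor bounded by the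
  number of children, and monotonicity keeps the first sequence small.\<close>

lemma not_survives_D:
  assumes "\<not> survives \<theta> p a b" "0 \<le> p" "p \<le> 1" "\<theta> \<le> a" "\<theta> \<le> b" "0 < e"
  shows "\<exists>n. survival \<theta> p a b n \<le> e \<and> survival \<theta> p b a n \<le> e"
proof -
  have *: "\<exists>n. survival \<theta> p a b n \<le> e \<and> survival \<theta> p b a n \<le> e"
    if n: "survival \<theta> p a b n < e / real (b + 1)" and "\<theta> \<le> b" for a b n
  proof -
    have "(1 - p) * (real b * survival \<theta> p a b n) \<le> 1 * (real (b + 1) * (e / real (b + 1)))"
      using n assms survival_bounds[OF assms(2,3)] by (intro mult_mono) auto
    then have "survival \<theta> p b a (Suc n) \<le> e"
      using survival_Suc_le[OF assms(2,3) \<open>\<theta> \<le> b\<close>, of a n] by simp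
    moreover have "e / real (b + 1) \<le> e"
      using \<open>0 < e\<close> by (simp add: field_simps)
    then have "survival \<theta> p a b (Suc n) \<le> e"
      using survival_Suc_le_self[OF assms(2,3), of \<theta> a b n] n by linarith
    ultimately show ?thesis by blast
  qed
  \<comment> \<open>The minimum serves whichever sequence becomes small; the \<open>+ 1\<close>
    keeps the denominators positive.\<close>
  have "\<exists>n. survival \<theta> p a b n < min (e / real (a + 1)) (e / real (b + 1)) \<or>
      survival \<theta> p b a n < min (e / real (a + 1)) (e / real (b + 1))"
    using assms(1) \<open>0 < e\<close> unfolding survives_def
    by (metis divide_pos_pos leI min_less_iff_conj of_nat_0_less_iff add_gr_0 zero_less_one)
  then show ?thesis
    using *[of a b] *[of b a] assms by (metis min_less_iff_conj)
qed

lemma survives_antimono: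
  assumes "survives \<theta> r a b" "0 \<le> p" "p \<le> r" "r \<le> 1"
  shows "survives \<theta> p a b"
  using assms(1) survival_antimono[OF assms(2-4), of \<theta>] unfolding survives_def
  by (meson order_trans)

lemma survives_threshold:
  assumes "2 \<le> \<theta>" "\<theta> < a" "\<theta> < b"
  shows "\<exists>p\<^sub>f\<in>{0<..<1}.
    (\<forall>p\<in>{0..1}. p\<^sub>f < p \<longrightarrow> \<not> survives \<theta> p a b) \<and>
    (\<forall>p\<in>{0..1}. p < p\<^sub>f \<longrightarrow> survives \<theta> p a b)"
proof -
  define m where "m = max a b"
  define S where "S = {p \<in> {0..1}. survives \<theta> p a b}"
  \<comment> \<open>\<open>l\<close> gives equality in the smallness condition of
    \<open>survival_ge\<close>, \<open>u\<close> in the contraction condition of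
    \<open>survival_le\<close>. They enclose the supremum and so keep it away from \<open>0\<close>
    and \<open>1\<close>.\<close>
  define l where "l = 1 / (4 * (real m)\<^sup>2)"
  define u where "u = 1 - 1 / (2 * real m)"
  have m: "3 \<le> m" "a \<le> m" "b \<le> m" using assms by (auto simp: m_def)
  have "1 * 1 \<le> (real m)\<^sup>2"
    using m unfolding power2_eq_square by (intro mult_mono) auto
  then have l: "0 < l" "l \<le> 1 / 4" "4 * l * (real m)\<^sup>2 \<le> 1"
    using m by (auto simp: l_def field_simps)
  have u: "0 \<le> u" "u < 1" "(1 - u) * real m \<le> 1 / 2"
    using m by (auto simp: u_def field_simps)
  have "survives \<theta> l a b"
    unfolding survives_def
    using survival_ge[of l \<theta> a m b] survival_ge[of l \<theta> b m a] l m assms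
    by (intro exI[of _ "1 - 2 * l"]) auto
  then have "l \<in> S" using l by (simp add: S_def)
  have "\<not> survives \<theta> u a b"
  proof
    assume "survives \<theta> u a b"
    then obtain \<epsilon> where "0 < \<epsilon>" and \<epsilon>: "\<And>n. \<epsilon> \<le> survival \<theta> u a b n"
      unfolding survives_def by auto
    obtain n where "(1 / 2) ^ n < \<epsilon>"
      using real_arch_pow_inv[of \<epsilon> "1 / 2"] \<open>0 < \<epsilon>\<close> by auto
    with \<epsilon>[of n] survival_le[of u \<theta> a b m n] u m assms show False by auto
  qed
  then have S_le: "p \<le> u" if "p \<in> S" for p
    using that survives_antimono[of \<theta> p a b u] u by (cases "u \<le> p") (auto simp: S_def)
  then have bdd: "bdd_above S" by (rule bdd_aboveI)
  have "l \<le> Sup S"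
    using \<open>l \<in> S\<close> bdd by (rule cSup_upper)
  moreover have "Sup S \<le> u"
    using \<open>l \<in> S\<close> S_le by (intro cSup_least) auto
  moreover have "\<not> survives \<theta> p a b" if "p \<in> {0..1}" "Sup S < p" for p
    using that cSup_upper[OF _ bdd, of p] by (auto simp: S_def)
  moreover have "survives \<theta> p a b" if p: "p \<in> {0..1}" "p < Sup S" for p
  proof -
    obtain r where "r \<in> S" "p < r"
      using less_cSupE[OF p(2)] \<open>l \<in> S\<close> by blast
    then show ?thesis
      using survives_antimono[of \<theta> r a b p] p by (auto simp: S_def)
  qed
  ultimately show ?thesis
    using l u by (intro bexI[of _ "Sup S"]) auto
qed

section \<open>Activation from below\<close>

definition children :: "nat \<Rightarrow> nat \<Rightarrow> nat list \<Rightarrow> nat list set" where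
  "children a b v = (\<lambda>i. i # v) ` {..<num_children a b v}"

text \<open>Lists grow at the head, so descent is the suffix order, in which the ancestors of a node
  are pairwise comparable.\<close>

definition subtree :: "nat \<Rightarrow> nat \<Rightarrow> nat list \<Rightarrow> nat list set" where
  "subtree a b v = {u \<in> tree_nodes a b. suffix v u}"

text \<open>Activation of a node while its parent is kept inactive.\<close>

primrec active_below ::
  "nat \<Rightarrow> nat \<Rightarrow> nat \<Rightarrow> nat \<Rightarrow> nat list \<Rightarrow> (nat list \<Rightarrow> bool) \<Rightarrow> bool" where
  "active_below a b \<theta> 0 v \<omega> \<longleftrightarrow> False"
| "active_below a b \<theta> (Suc n) v \<omega> \<longleftrightarrow>
     \<omega> v \<or> \<theta> \<le> card {u \<in> children a b v. active_below a b \<theta> n u \<omega>}"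

text \<open>With \<open>2 \<le> \<theta>\<close>, such a node has too few potentially active neighbours ever to be activated.\<close>

definition blocked :: "nat \<Rightarrow> nat \<Rightarrow> nat \<Rightarrow> nat list \<Rightarrow> (nat list \<Rightarrow> bool) \<Rightarrow> bool" where
  "blocked a b \<theta> v \<omega> \<longleftrightarrow> \<not> \<omega> v \<and> (\<forall>u\<in>children a b v. \<forall>n. \<not> active_below a b \<theta> n u \<omega>)"

lemma finite_children [simp]: "finite (children a b v)"
  by (simp add: children_def)

lemma card_children: "card (children a b v) = num_children a b v"
  unfolding children_def by (subst card_image) (auto simp: inj_on_def)

lemma childrenD: "u \<in> children a b v \<Longrightarrow> \<exists>i. u = i # v"
  by (auto simp: children_def)

lemma children_in_nodes: "v \<in> tree_nodes a b \<Longrightarrow> u \<in> children a b v \<Longrightarrow> u \<in> tree_nodes a b"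
  by (auto simp: children_def Cons_in_tree_nodes_iff)

lemma tree_edges_children:
  "v \<in> tree_nodes a b \<Longrightarrow> u \<in> children a b v \<Longrightarrow> (v, u) \<in> tree_edges a b"
  by (auto simp: children_def tree_edges_def Cons_in_tree_nodes_iff)

lemma tree_edges_cases:
  assumes "(v, u) \<in> tree_edges a b"
  obtains "u \<in> children a b v" | i where "v = i # u"
  using assms by (auto simp: children_def tree_edges_def Cons_in_tree_nodes_iff)

section \<open>Activation from below compared with the full dynamics\<close>

lemma active_below_mono:
  assumes "active_below a b \<theta> m v \<omega>" "m \<le> n"
  shows "active_below a b \<theta> n v \<omega>"
  using assms
proof (induction m arbitrary: n v)
  case (Suc m)
  then obtain k where k: "n = Suc k" "m \<le> k" by (cases n) auto
  have "card {u \<in> children a b v. active_below a b \<theta> m u \<omega>}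
     \<le> card {u \<in> children a b v. active_below a b \<theta> k u \<omega>}"
    using Suc.IH k by (intro card_mono) auto
  with Suc.prems k show ?case by auto
qed simp

lemma active_below_uniform:
  assumes "finite S" "\<And>u. u \<in> S \<Longrightarrow> \<exists>n. active_below a b \<theta> n u \<omega>"
  shows "\<exists>N. \<forall>u\<in>S. active_below a b \<theta> N u \<omega>"
proof -
  obtain f where f: "\<And>u. u \<in> S \<Longrightarrow> active_below a b \<theta> (f u) u \<omega>"
    using assms(2) by metis
  have "active_below a b \<theta> (Max (f ` S)) u \<omega>" if "u \<in> S" for u
    using f[OF that] \<open>finite S\<close> that by (intro active_below_mono[OF f[OF that]]) auto
  then show ?thesis by blast
qed

text \<open>There are finitely many children, so one number of rounds serves all those that are ever
  activated.\<close>

lemma active_below_if_children: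
  assumes "\<theta> \<le> card {u \<in> children a b v. \<exists>n. active_below a b \<theta> n u \<omega>}"
  shows "\<exists>n. active_below a b \<theta> n v \<omega>"
proof -
  let ?S = "{u \<in> children a b v. \<exists>n. active_below a b \<theta> n u \<omega>}"
  have "finite ?S" by simp
  then have "\<exists>N. \<forall>u\<in>?S. active_below a b \<theta> N u \<omega>"
    by (rule active_below_uniform) simp
  then obtain N where "\<forall>u\<in>?S. active_below a b \<theta> N u \<omega>" ..
  then have "?S = {u \<in> children a b v. active_below a b \<theta> N u \<omega>}"
    by blast
  with assms have "active_below a b \<theta> (Suc N) v \<omega>" by simp
  then show ?thesis by blast
qed

text \<open>\<open>active_below\<close> lags one round behind: it starts from \<open>False\<close>,
  \<open>active_at\<close> from the initial state. The same index \<open>n\<close> therefore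
  suffices.\<close>

lemma active_below_imp_active_at:
  assumes "active_below a b \<theta> n v \<omega>" "v \<in> tree_nodes a b"
  shows "active_at (tree_edges a b) \<theta> \<omega> n v"
  using assms
proof (induction n arbitrary: v)
  case (Suc n)
  have init: "active_at (tree_edges a b) \<theta> \<omega> t v" if "\<omega> v" for t
    using that by (induction t) auto
  have "card {u \<in> children a b v. active_below a b \<theta> n u \<omega>}
     \<le> card {u. (v, u) \<in> tree_edges a b \<and> active_at (tree_edges a b) \<theta> \<omega> n u}"
    using Suc tree_degree(1)[of v a b]
    by (intro card_mono) (auto intro: tree_edges_children children_in_nodes)
  with Suc.prems(1) init show ?case by auto
qed simp

text \<open>The root has \<open>a + 1\<close> children and does not follow the recursion; it is
  activated by its children, all of which are active eventually.\<close>

lemma fully_active_if_below: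
  assumes "\<theta> \<le> a"
    and "\<And>v. v \<in> tree_nodes a b \<Longrightarrow> v \<noteq> [] \<Longrightarrow> \<exists>n. active_below a b \<theta> n v \<omega>"
  shows "becomes_fully_active (tree_nodes a b) (tree_edges a b) \<theta> \<omega>"
proof -
  have "{u \<in> children a b []. \<exists>n. active_below a b \<theta> n u \<omega>} = children a b []"
    using assms(2) children_in_nodes[OF tree_nodes.root] by (auto simp: children_def)
  then have "\<exists>n. active_below a b \<theta> n [] \<omega>"
    using \<open>\<theta> \<le> a\<close> by (intro active_below_if_children) (simp add: card_children num_children_def)
  with assms(2) show ?thesis
    unfolding becomes_fully_active_def using active_below_imp_active_at by metis
qed

text \<open>Whether a child of \<open>w\<close> stays inactive depends on \<open>w\<close> and on
  its own children, so the induction over time needs a whole cluster of nodes that keep each other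
  inactive.\<close>

inductive_set frozen :: "nat \<Rightarrow> nat \<Rightarrow> nat \<Rightarrow> nat list \<Rightarrow> (nat list \<Rightarrow> bool) \<Rightarrow> nat list set"
  for a b \<theta> w \<omega> where
  base: "w \<in> frozen a b \<theta> w \<omega>"
| child: "x \<in> frozen a b \<theta> w \<omega> \<Longrightarrow> v \<in> children a b x \<Longrightarrow>
    (\<And>n. \<not> active_below a b \<theta> n v \<omega>) \<Longrightarrow> v \<in> frozen a b \<theta> w \<omega>"

text \<open>All nodes of the cluster stay inactive together. At \<open>w\<close> only the parent can
  be active, and one neighbour is below the threshold. Elsewhere the parent is in the cluster, and
  fewer than \<open>\<theta>\<close> children are ever activated from below.\<close>

lemma blocked_never_active:
  assumes "2 \<le> \<theta>" "blocked a b \<theta> w \<omega>"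
  shows "\<not> active_at (tree_edges a b) \<theta> \<omega> t w"
proof -
  let ?act = "active_at (tree_edges a b) \<theta> \<omega>"
  have "\<not> ?act t v" if "v \<in> frozen a b \<theta> w \<omega>" for v
    using that
  proof (induction t arbitrary: v)
    case 0
    from 0 show ?case
    proof cases
      case base
      with assms(2) show ?thesis by (simp add: blocked_def)
    next
      case (child x)
      \<comment> \<open>One round of \<open>active_below\<close> already sees the initial
        state.\<close>
      from child(3)[of 1] show ?thesis by simp
    qed
  next
    case (Suc t)
    have "card {u. (v, u) \<in> tree_edges a b \<and> ?act t u} < \<theta>"
      using Suc.prems
    proof cases
      case base
      \<comment> \<open>\<open>tl w\<close> is the parent of \<open>w\<close>; if \<open>w\<close>
        is the root, the default value \<open>tl [] = []\<close> is harmless.\<close>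
      have "{u. (v, u) \<in> tree_edges a b \<and> ?act t u} \<subseteq> {tl w}"
      proof safe
        fix u assume u: "(v, u) \<in> tree_edges a b" "?act t u"
        from u(1) show "u = tl w"
        proof (cases rule: tree_edges_cases)
          case 1
          with assms(2) base have "u \<in> frozen a b \<theta> w \<omega>"
            by (intro frozen.child[OF frozen.base]) (auto simp: blocked_def)
          with Suc.IH u(2) show ?thesis by blast
        qed (use base in auto)
      qed
      then have "card {u. (v, u) \<in> tree_edges a b \<and> ?act t u} \<le> card {tl w}"
        by (intro card_mono) auto
      with \<open>2 \<le> \<theta>\<close> show ?thesis by simp
    next
      case (child x)
      have "{u. (v, u) \<in> tree_edges a b \<and> ?act t u}
         \<subseteq> {u \<in> children a b v. \<exists>n. active_below a b \<theta> n u \<omega>}"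
      proof safe
        fix u assume u: "(v, u) \<in> tree_edges a b" "?act t u"
        have "u \<noteq> x" using Suc.IH[OF child(1)] u(2) by blast
        with u(1) childrenD[OF child(2)] show "u \<in> children a b v"
          by (auto elim: tree_edges_cases)
        with Suc.IH[OF frozen.child[OF Suc.prems]] u(2) show "\<exists>n. active_below a b \<theta> n u \<omega>"
          by blast
      qed
      then have "card {u. (v, u) \<in> tree_edges a b \<and> ?act t u}
         \<le> card {u \<in> children a b v. \<exists>n. active_below a b \<theta> n u \<omega>}"
        by (intro card_mono) auto
      moreover have "card {u \<in> children a b v. \<exists>n. active_below a b \<theta> n u \<omega>} < \<theta>"
        using active_below_if_children child(3) by (meson not_le)
      ultimately show ?thesis by simp
    qed
    with Suc show ?case by simp
  qed
  then show ?thesis by (simp add: frozen.base)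
qed


section \<open>Independence of disjoint subtrees\<close>

lemma (in prob_space) indep_vars_coordinates:
  "prob_space.indep_vars (Pi\<^sub>M V (\<lambda>_. M)) (\<lambda>_. M) (\<lambda>v \<omega>. \<omega> v) V"
proof -
  interpret P: prob_space "Pi\<^sub>M V (\<lambda>_. M)"
    by (intro prob_space_PiM prob_space_axioms)
  show ?thesis
  \<comment> \<open>The characterisation of independence by the joint distribution is for nonempty
    index sets.\<close>
  proof (cases "V = {}")
    case True
    then show ?thesis
      unfolding P.indep_vars_def P.indep_sets_def by auto
  next
    case False
    have "distr (Pi\<^sub>M V (\<lambda>_. M)) (Pi\<^sub>M V (\<lambda>_. M)) (\<lambda>x. \<lambda>i\<in>V. x i)
       = distr (Pi\<^sub>M V (\<lambda>_. M)) (Pi\<^sub>M V (\<lambda>_. M)) (\<lambda>x. x)"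
      by (intro distr_cong) (auto simp: space_PiM)
    also have "\<dots> = Pi\<^sub>M V (\<lambda>_. M)" by (simp add: distr_id2)
    also have "\<dots> = (\<Pi>\<^sub>M i\<in>V. distr (Pi\<^sub>M V (\<lambda>_. M)) M (\<lambda>\<omega>. \<omega> i))"
      using prob_space_axioms
      by (intro PiM_cong refl distr_PiM_component[where M = "\<lambda>_. M", symmetric]) auto
    finally show ?thesis
      using False by (subst P.indep_vars_iff_distr_eq_PiM') auto
  qed
qed

text \<open>Disjoint blocks of independent coordinates are independent. Locality lets
  \<open>Y j\<close> be evaluated on the full configuration although it is measurable on its
  block.\<close>

lemma indep_vars_disjoint_supports:
  assumes "\<And>j. j \<in> L \<Longrightarrow> K j \<subseteq> V" "disjoint_family_on K L"
    and meas: "\<And>j. j \<in> L \<Longrightarrow> Measurable.pred (initial_measure (K j) p) (Y j)"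
    and local: "\<And>j \<omega>. j \<in> L \<Longrightarrow> Y j (restrict \<omega> (K j)) = Y j \<omega>"
  shows "prob_space.indep_vars (initial_measure V p) (\<lambda>_. count_space UNIV) Y L"
proof -
  interpret prob_space "initial_measure V p" by (rule prob_space_initial_measure)
  have "indep_vars (\<lambda>_. measure_pmf (bernoulli_pmf p)) (\<lambda>v \<omega>. \<omega> v) V"
    unfolding initial_measure_def by (rule measure_pmf.indep_vars_coordinates)
  from indep_vars_restrict[OF this assms(1,2)]
  have "indep_vars (\<lambda>j. initial_measure (K j) p) (\<lambda>j \<omega>. restrict \<omega> (K j)) L"
    by (simp add: initial_measure_def)
  from indep_vars_compose2[OF this meas]
  have "indep_vars (\<lambda>_. count_space UNIV) (\<lambda>j \<omega>. Y j (restrict \<omega> (K j))) L" .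
  then show ?thesis
    using local by (subst (asm) indep_vars_cong[OF refl _ refl]) auto
qed

section \<open>Events determined by a subtree\<close>

lemma subtree_children: "u \<in> children a b v \<Longrightarrow> subtree a b u \<subseteq> subtree a b v"
  by (auto simp: subtree_def children_def dest: suffix_ConsD)

lemma subtree_refl: "v \<in> tree_nodes a b \<Longrightarrow> v \<in> subtree a b v"
  by (simp add: subtree_def)

lemma active_below_local:
  assumes "v \<in> tree_nodes a b" "\<And>u. u \<in> subtree a b v \<Longrightarrow> \<omega> u = \<omega>' u"
  shows "active_below a b \<theta> n v \<omega> \<longleftrightarrow> active_below a b \<theta> n v \<omega>'"
  using assms
proof (induction n arbitrary: v)
  case (Suc n)
  have "{u \<in> children a b v. active_below a b \<theta> n u \<omega>} = {u \<in> children a b v. active_below a b \<theta> n u \<omega>'}"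
    using Suc children_in_nodes subtree_children by blast
  with Suc subtree_refl show ?case by auto
qed simp

lemma measurable_coordinate:
  assumes "v \<in> W"
  shows "Measurable.pred (initial_measure W p) (\<lambda>\<omega>. \<omega> v)"
proof -
  have "(\<lambda>\<omega>. \<omega> v) \<in> measurable (initial_measure W p) (measure_pmf (bernoulli_pmf p))"
    unfolding initial_measure_def using assms by (rule measurable_component_singleton)
  then show ?thesis by (simp add: measurable_def)
qed

text \<open>\<open>W\<close> is the subtree itself when independence is derived and the whole tree
  when probabilities are computed.\<close>

lemma measurable_active_below:
  assumes "v \<in> tree_nodes a b" "subtree a b v \<subseteq> W"
  shows "Measurable.pred (initial_measure W p) (active_below a b \<theta> n v)"
  using assms
proof (induction n arbitrary: v)
  case 0
  have "Measurable.pred (initial_measure W p) (\<lambda>\<omega>. active_below a b \<theta> 0 v \<omega>)"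
    unfolding active_below.simps by simp
  then show ?case .
next
  case (Suc n)
  let ?C = "children a b v"
  \<comment> \<open>A finite disjunction over sets of children replaces the cardinality, which makes
    measurability a matter of logical closure.\<close>
  have eq: "\<theta> \<le> card {u \<in> ?C. active_below a b \<theta> n u \<omega>} \<longleftrightarrow>
      (\<exists>S\<in>{S. S \<subseteq> ?C \<and> \<theta> \<le> card S}. \<forall>u\<in>S. active_below a b \<theta> n u \<omega>)" for \<omega>
  proof
    assume "\<exists>S\<in>{S. S \<subseteq> ?C \<and> \<theta> \<le> card S}. \<forall>u\<in>S. active_below a b \<theta> n u \<omega>"
    then obtain S where "\<theta> \<le> card S" "S \<subseteq> {u \<in> ?C. active_below a b \<theta> n u \<omega>}" by auto
    then show "\<theta> \<le> card {u \<in> ?C. active_below a b \<theta> n u \<omega>}"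
      using card_mono[of "{u \<in> ?C. active_below a b \<theta> n u \<omega>}" S] by simp
  qed (auto intro!: exI[of _ "{u \<in> ?C. active_below a b \<theta> n u \<omega>}"])
  have "finite S" if "S \<subseteq> ?C" for S
    using that finite_children by (rule finite_subset)
  moreover have child: "Measurable.pred (initial_measure W p) (active_below a b \<theta> n u)"
    if "u \<in> ?C" for u
    using Suc.IH[of u] Suc.prems children_in_nodes[OF _ that] subtree_children[OF that] by blast
  ultimately have "Measurable.pred (initial_measure W p)
      (\<lambda>\<omega>. \<exists>S\<in>{S. S \<subseteq> ?C \<and> \<theta> \<le> card S}. \<forall>u\<in>S. active_below a b \<theta> n u \<omega>)"
    using child by (intro pred_intros_finite) auto
  moreover have "Measurable.pred (initial_measure W p) (\<lambda>\<omega>. \<omega> v)"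
    using Suc.prems subtree_refl by (intro measurable_coordinate) auto
  ultimately have "Measurable.pred (initial_measure W p) (\<lambda>\<omega>. active_below a b \<theta> (Suc n) v \<omega>)"
    unfolding active_below.simps eq by (intro pred_intros_logic)
  then show ?case .
qed

lemma measurable_blocked:
  assumes "v \<in> tree_nodes a b" "subtree a b v \<subseteq> W"
  shows "Measurable.pred (initial_measure W p) (blocked a b \<theta> v)"
proof -
  have "Measurable.pred (initial_measure W p)
      (\<lambda>\<omega>. \<not> \<omega> v \<and> (\<forall>u\<in>children a b v. \<forall>n. \<not> active_below a b \<theta> n u \<omega>))"
    using assms subtree_refl children_in_nodes subtree_children
    by (intro pred_intros_logic pred_intros_finite pred_intros_countable measurable_coordinate
        measurable_active_below finite_children) blast+
  then show ?thesis unfolding blocked_def[abs_def] .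
qed

lemma blocked_local:
  assumes "v \<in> tree_nodes a b" "\<And>u. u \<in> subtree a b v \<Longrightarrow> \<omega> u = \<omega>' u"
  shows "blocked a b \<theta> v \<omega> \<longleftrightarrow> blocked a b \<theta> v \<omega>'"
proof -
  have "active_below a b \<theta> n u \<omega> = active_below a b \<theta> n u \<omega>'" if "u \<in> children a b v" for u n
    using assms children_in_nodes[OF _ that] subtree_children[OF that]
    by (intro active_below_local) auto
  then show ?thesis
    unfolding blocked_def using assms subtree_refl by auto
qed

section \<open>Probabilities of activation at a node\<close>

lemma prob_coordinate:
  assumes "v \<in> V" "0 \<le> p" "p \<le> 1"
  shows "measure (initial_measure V p) {\<omega> \<in> space (initial_measure V p). \<omega> v = False} = 1 - p"
proof -
  let ?N = "measure_pmf (bernoulli_pmf p)"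
  have m: "(\<lambda>\<omega>. \<omega> v) \<in> measurable (initial_measure V p) ?N"
    unfolding initial_measure_def using assms(1) by (rule measurable_component_singleton)
  have "distr (initial_measure V p) ?N (\<lambda>\<omega>. \<omega> v) = ?N"
    unfolding initial_measure_def using assms(1)
    by (intro distr_PiM_component) (auto intro: measure_pmf.prob_space_axioms)
  then have "measure (initial_measure V p) ((\<lambda>\<omega>. \<omega> v) -` {False} \<inter> space (initial_measure V p))
      = measure ?N {False}"
    using measure_distr[OF m, of "{False}"] by simp
  also have "(\<lambda>\<omega>. \<omega> v) -` {False} \<inter> space (initial_measure V p) =
      {\<omega> \<in> space (initial_measure V p). \<omega> v = False}" by auto
  also have "measure ?N {False} = 1 - p"
    using assms by (simp add: measure_pmf_single)
  finally show ?thesis .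
qed

text \<open>With \<open>k = \<theta>\<close> this is one step of the recursion; with
  \<open>k = 1\<close> it says that no child is active, as needed for
  \<open>blocked\<close>.\<close>

lemma prob_few_active_children:
  fixes a b :: nat and p :: real
  defines "V \<equiv> tree_nodes a b"
  defines "M \<equiv> initial_measure V p"
  assumes "v \<in> V" "0 \<le> p" "p \<le> 1"
    and q: "\<And>u. u \<in> children a b v \<Longrightarrow>
      measure M {\<omega> \<in> space M. active_below a b \<theta> n u \<omega>} = q"
  shows "measure M {\<omega> \<in> space M. \<not> \<omega> v \<and> card {u \<in> children a b v. active_below a b \<theta> n u \<omega>} < k}
    = (1 - p) * binomial_below (num_children a b v) k q"
proof -
  interpret prob_space M unfolding M_def by (rule prob_space_initial_measure)
  \<comment> \<open>The index \<open>v\<close> carries the initial state of the node itself, so that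
    one independent family covers it and the children.\<close>
  define Z where "Z u \<omega> = (if u = v then \<omega> v else active_below a b \<theta> n u \<omega>)" for u \<omega>
  define K where "K u = (if u = v then {v} else subtree a b u)" for u
  have ne: "u \<noteq> v" if "u \<in> children a b v" for u
    using childrenD[OF that] by auto
  have "indep_vars (\<lambda>_. count_space UNIV) Z (children a b v \<union> {v})"
    unfolding M_def
  proof (rule indep_vars_disjoint_supports[where K = K])
    show "K u \<subseteq> V" if "u \<in> children a b v \<union> {v}" for u
      using \<open>v \<in> V\<close> by (auto simp: K_def V_def subtree_def)
    have no: "\<not> suffix (i # v) v" for i
      by (auto dest: suffix_length_le)
    \<comment> \<open>Two suffixes of one list are comparable, and comparable siblings
      coincide.\<close>
    then have "suffix x u \<Longrightarrow> suffix y u \<Longrightarrow> x = y"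
      if "x \<in> children a b v" "y \<in> children a b v" for x y u
      using that suffix_same_cases[of x u y] by (auto simp: children_def suffix_Cons)
    moreover have "\<not> suffix u v" if "u \<in> children a b v" for u
      using that no by (auto simp: children_def)
    ultimately show "disjoint_family_on K (children a b v \<union> {v})"
      by (auto simp: disjoint_family_on_def K_def subtree_def)
    show "Measurable.pred (initial_measure (K u) p) (Z u)" if "u \<in> children a b v \<union> {v}" for u
    proof (cases "u = v")
      case True
      then show ?thesis
        using measurable_coordinate[of v "{v}" p] by (simp add: Z_def[abs_def] K_def)
    next
      case False
      with that show ?thesis
        using measurable_active_below[of u a b "subtree a b u"] children_in_nodes[of v a b u] \<open>v \<in> V\<close>
        by (simp add: Z_def[abs_def] K_def V_def)
    qed
    show "Z u (restrict \<omega> (K u)) = Z u \<omega>" if "u \<in> children a b v \<union> {v}" for u \<omega>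
    proof (cases "u = v")
      case False
      with that show ?thesis
        using active_below_local[of u a b "restrict \<omega> (subtree a b u)" \<omega> \<theta> n]
          children_in_nodes[of v a b u] \<open>v \<in> V\<close>
        by (simp add: Z_def K_def V_def)
    qed (simp add: Z_def K_def)
  qed
  moreover have "children a b v \<inter> {v} = {}" using ne by auto
  moreover have "{\<omega> \<in> space M. Z u \<omega>} = {\<omega> \<in> space M. active_below a b \<theta> n u \<omega>}"
    if "u \<in> children a b v" for u
    using ne[OF that] by (simp add: Z_def)
  ultimately have "prob {\<omega> \<in> space M. (\<forall>j\<in>{v}. Z j \<omega> = False) \<and> card {i \<in> children a b v. Z i \<omega>} < k} =
     (\<Prod>j\<in>{v}. prob {\<omega> \<in> space M. Z j \<omega> = False}) * binomial_below (card (children a b v)) k q"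
    using q by (intro prob_card_less) auto
  moreover have "{i \<in> children a b v. Z i \<omega>} = {u \<in> children a b v. active_below a b \<theta> n u \<omega>}" for \<omega>
    using ne by (auto simp: Z_def)
  moreover have "Z v \<omega> = \<omega> v" for \<omega> by (simp add: Z_def)
  ultimately show ?thesis
    using prob_coordinate[OF \<open>v \<in> V\<close> assms(4,5)] by (simp add: card_children M_def)
qed

text \<open>The parity of the depth selects the type. The root is excluded because of its additional
  child.\<close>

lemma prob_active_below:
  fixes a b :: nat and p :: real
  defines "V \<equiv> tree_nodes a b"
  defines "M \<equiv> initial_measure V p"
  assumes "v \<in> V" "v \<noteq> []" "0 \<le> p" "p \<le> 1"
  shows "measure M {\<omega> \<in> space M. active_below a b \<theta> n v \<omega>} =
    1 - (if even (length v) then survival \<theta> p a b n else survival \<theta> p b a n)"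
  using assms(3,4)
proof (induction n arbitrary: v)
  case (Suc n)
  interpret prob_space M unfolding M_def by (rule prob_space_initial_measure)
  let ?q = "1 - (if even (length v) then survival \<theta> p b a n else survival \<theta> p a b n)"
  have "prob {\<omega> \<in> space M. active_below a b \<theta> n u \<omega>} = ?q" if "u \<in> children a b v" for u
    using Suc.IH[of u] childrenD[OF that] children_in_nodes[OF _ that] Suc.prems by (auto simp: V_def)
  then have "prob {\<omega> \<in> space M. \<not> \<omega> v \<and> card {u \<in> children a b v. active_below a b \<theta> n u \<omega>} < \<theta>}
      = (1 - p) * binomial_below (num_children a b v) \<theta> ?q"
    using Suc.prems assms(5,6) unfolding M_def V_def by (intro prob_few_active_children) auto
  also have "{\<omega> \<in> space M. \<not> \<omega> v \<and> card {u \<in> children a b v. active_below a b \<theta> n u \<omega>} < \<theta>}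
      = {\<omega> \<in> space M. \<not> active_below a b \<theta> (Suc n) v \<omega>}"
    by auto
  finally have *: "prob {\<omega> \<in> space M. \<not> active_below a b \<theta> (Suc n) v \<omega>}
      = (1 - p) * binomial_below (num_children a b v) \<theta> ?q" .
  have "{\<omega> \<in> space M. active_below a b \<theta> (Suc n) v \<omega>} \<in> events"
    using measurable_active_below[of v a b V] Suc.prems
    unfolding M_def V_def by (simp add: pred_def subtree_def del: active_below.simps)
  from prob_neg[OF this] * have "prob {\<omega> \<in> space M. active_below a b \<theta> (Suc n) v \<omega>}
      = 1 - (1 - p) * binomial_below (num_children a b v) \<theta> ?q"
    by linarith
  with Suc.prems(2) show ?case
    by (simp add: num_children_def del: active_below.simps)
qed simp


section \<open>The two regimes\<close>

text \<open>Each non-root node is activated from below with probability at least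
  \<open>1 - e\<close> for every \<open>e > 0\<close>, hence almost surely; the tree is countable,
  so this holds for all such nodes at once.\<close>

lemma fully_active_prob_eq_1:
  assumes "\<not> survives \<theta> p a b" "0 \<le> p" "p \<le> 1" "\<theta> \<le> a" "\<theta> \<le> b"
  shows "fully_active_prob (tree_nodes a b) (tree_edges a b) \<theta> p = 1"
proof -
  let ?V = "tree_nodes a b"
  let ?M = "initial_measure ?V p"
  interpret prob_space ?M by (rule prob_space_initial_measure)
  have ev: "{\<omega> \<in> space ?M. active_below a b \<theta> n v \<omega>} \<in> events" if "v \<in> ?V" for v n
    using measurable_active_below[OF that, of ?V] by (simp add: pred_def subtree_def)
  have "AE \<omega> in ?M. \<exists>n. active_below a b \<theta> n v \<omega>" if v: "v \<in> ?V" "v \<noteq> []" for v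
  proof -
    let ?E = "{\<omega> \<in> space ?M. \<exists>n. active_below a b \<theta> n v \<omega>}"
    have E: "?E \<in> events"
      using ev[OF v(1)] by (rule sets.sets_Collect_countable_Ex)
    have "1 \<le> prob ?E + e" if e: "0 < e" for e
    proof -
      obtain n where "survival \<theta> p a b n \<le> e" "survival \<theta> p b a n \<le> e"
        using not_survives_D[OF assms e] by blast
      then have "1 - e \<le> prob {\<omega> \<in> space ?M. active_below a b \<theta> n v \<omega>}"
        using prob_active_below[OF v assms(2,3), of \<theta> n] by simp
      also have "\<dots> \<le> prob ?E"
        using E by (intro finite_measure_mono) auto
      finally show ?thesis by simp
    qed
    then have "1 \<le> prob ?E"
      by (rule field_le_epsilon)
    then have "prob ?E = 1"
      using prob_le_1[of ?E] by simp
    then show ?thesis using E by (simp add: prob_Collect_eq_1)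
  qed
  then have "AE \<omega> in ?M. \<forall>v\<in>?V - {[]}. \<exists>n. active_below a b \<theta> n v \<omega>"
    by (subst AE_ball_countable) auto
  then have "AE \<omega> in ?M. becomes_fully_active ?V (tree_edges a b) \<theta> \<omega>"
    by eventually_elim (use assms(4) in \<open>auto intro!: fully_active_if_below\<close>)
  then show ?thesis
    unfolding fully_active_prob_def
    using sets_tree_becomes_fully_active[of a b p \<theta>] by (simp add: prob_Collect_eq_1)
qed

text \<open>The bound holds for survival of the children over any \<open>n\<close> rounds; these
  events decrease in \<open>n\<close>, so continuity from above passes it to their
  intersection.\<close>

lemma prob_blocked_ge:
  fixes a b :: nat and p :: real
  defines "M \<equiv> initial_measure (tree_nodes a b) p"
  assumes "v \<in> tree_nodes a b" "v \<noteq> []" "0 \<le> p" "p \<le> 1" "0 \<le> \<epsilon>"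
    and \<epsilon>: "\<And>n. \<epsilon> \<le> survival \<theta> p a b n" "\<And>n. \<epsilon> \<le> survival \<theta> p b a n"
  shows "(1 - p) * \<epsilon> ^ max a b \<le> measure M {\<omega> \<in> space M. blocked a b \<theta> v \<omega>}"
proof -
  interpret prob_space M unfolding M_def by (rule prob_space_initial_measure)
  let ?E = "\<lambda>n. {\<omega> \<in> space M. \<not> \<omega> v \<and> card {u \<in> children a b v. active_below a b \<theta> n u \<omega>} < 1}"
  have none: "card {u \<in> children a b v. active_below a b \<theta> n u \<omega>} < 1 \<longleftrightarrow>
      (\<forall>u\<in>children a b v. \<not> active_below a b \<theta> n u \<omega>)" for n \<omega>
    by auto
  have "\<epsilon> \<le> 1" using \<epsilon>(1)[of 0] by simp
  have ge: "(1 - p) * \<epsilon> ^ max a b \<le> prob (?E n)" for n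
  proof -
    let ?s = "if even (length v) then survival \<theta> p b a n else survival \<theta> p a b n"
    have "prob {\<omega> \<in> space M. active_below a b \<theta> n u \<omega>} = 1 - ?s" if "u \<in> children a b v" for u
      using prob_active_below[of u a b p \<theta> n] childrenD[OF that] children_in_nodes[OF _ that] assms(2-5)
      by (auto simp: M_def)
    then have "prob (?E n) = (1 - p) * ?s ^ num_children a b v"
      using prob_few_active_children[of v a b p \<theta> n "1 - ?s" 1] assms(2-5)
      unfolding binomial_below_1 M_def by simp
    \<comment> \<open>The exponent \<open>max a b\<close> makes the bound the same for all non-root
      nodes.\<close>
    moreover have "\<epsilon> ^ max a b \<le> \<epsilon> ^ num_children a b v"
      using \<open>0 \<le> \<epsilon>\<close> \<open>\<epsilon> \<le> 1\<close> \<open>v \<noteq> []\<close> by (intro power_decreasing) (auto simp: num_children_def)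
    moreover have "\<epsilon> ^ num_children a b v \<le> ?s ^ num_children a b v"
      using \<epsilon> \<open>0 \<le> \<epsilon>\<close> by (intro power_mono) auto
    ultimately show ?thesis
      using \<open>p \<le> 1\<close> by (simp add: mult_left_mono)
  qed
  have ev: "?E n \<in> events" for n
  proof -
    have "Measurable.pred M (\<lambda>\<omega>. \<not> \<omega> v \<and> (\<forall>u\<in>children a b v. \<not> active_below a b \<theta> n u \<omega>))"
      unfolding M_def using assms(2) children_in_nodes
      by (intro pred_intros_logic pred_intros_finite measurable_coordinate
        measurable_active_below finite_children) (auto simp: subtree_def)
    then show ?thesis unfolding none by (simp add: pred_def)
  qed
  have "decseq ?E"
    unfolding none decseq_def using active_below_mono by blast
  then have "(\<lambda>n. prob (?E n)) \<longlonglongrightarrow> prob (\<Inter>n. ?E n)"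
    using ev by (intro finite_Lim_measure_decseq) auto
  then have "(1 - p) * \<epsilon> ^ max a b \<le> prob (\<Inter>n. ?E n)"
    by (rule LIMSEQ_le_const) (use ge in blast)
  also have "(\<Inter>n. ?E n) = {\<omega> \<in> space M. blocked a b \<theta> v \<omega>}"
    unfolding none blocked_def by auto
  finally show ?thesis .
qed

lemma fully_active_prob_eq_0:
  assumes "survives \<theta> p a b" "0 \<le> p" "p < 1" "2 \<le> \<theta>" "\<theta> < a" "\<theta> < b"
  shows "fully_active_prob (tree_nodes a b) (tree_edges a b) \<theta> p = 0"
proof -
  let ?V = "tree_nodes a b"
  let ?M = "initial_measure ?V p"
  interpret prob_space ?M by (rule prob_space_initial_measure)
  \<comment> \<open>The nodes branch off a single ray of zeros, each by a final step to child
    \<open>1\<close>, so their subtrees are disjoint.\<close>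
  define w :: "nat \<Rightarrow> nat list" where "w k = 1 # replicate k 0" for k
  have w: "w k \<in> ?V" "w k \<noteq> []" for k
  proof -
    have "replicate k 0 \<in> ?V"
      using assms by (induction k) (auto simp: tree_nodes.root Cons_in_tree_nodes_iff num_children_def)
    then show "w k \<in> ?V" "w k \<noteq> []"
      using assms by (auto simp: w_def Cons_in_tree_nodes_iff num_children_def)
  qed
  have "\<not> suffix (w k) u \<or> \<not> suffix (w l) u" if "k \<noteq> l" for k l u
  proof -
    have "\<not> suffix (w i) (w j)" if "i \<noteq> j" for i j
      \<comment> \<open>A proper suffix relation would put the entry \<open>1\<close> into a list of
        zeros.\<close>
      using that set_mono_suffix[of "w i" "replicate j 0"] by (auto simp: w_def suffix_Cons)
    with that show ?thesis using suffix_same_cases by metis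
  qed
  then have disj: "disjoint_family_on (\<lambda>k. subtree a b (w k)) UNIV"
    by (auto simp: disjoint_family_on_def subtree_def)
  have indep: "indep_vars (\<lambda>_. count_space UNIV) (\<lambda>k. blocked a b \<theta> (w k)) UNIV"
  proof (rule indep_vars_disjoint_supports[OF _ disj])
    show "blocked a b \<theta> (w k) (restrict \<omega> (subtree a b (w k))) = blocked a b \<theta> (w k) \<omega>" for k \<omega>
      by (rule blocked_local) (auto simp: w)
  qed (auto simp: subtree_def intro!: measurable_blocked w)
  obtain \<epsilon> where \<epsilon>: "0 < \<epsilon>" "\<And>n. \<epsilon> \<le> survival \<theta> p a b n" "\<And>n. \<epsilon> \<le> survival \<theta> p b a n"
    using assms(1) unfolding survives_def by blast
  define \<delta> where "\<delta> = (1 - p) * \<epsilon> ^ max a b"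
  have "0 < \<delta>" using \<epsilon>(1) \<open>p < 1\<close> by (simp add: \<delta>_def)
  have ev: "{\<omega> \<in> space ?M. blocked a b \<theta> (w k) \<omega>} \<in> events" for k
    using measurable_blocked[OF w(1), of k ?V] by (simp add: pred_def subtree_def)
  have \<delta>: "\<delta> \<le> prob {\<omega> \<in> space ?M. blocked a b \<theta> (w k) \<omega>}" for k
    unfolding \<delta>_def using w \<epsilon> assms by (intro prob_blocked_ge) auto
  have "\<delta> \<le> 1" using order_trans[OF \<delta> prob_le_1] .
  let ?F = "{\<omega> \<in> space ?M. becomes_fully_active ?V (tree_edges a b) \<theta> \<omega>}"
  have le: "prob ?F \<le> (1 - \<delta>) ^ Suc n" for n
  proof -
    let ?N = "\<lambda>k. blocked a b \<theta> (w k) -` {False} \<inter> space ?M"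
    have N: "?N k = {\<omega> \<in> space ?M. \<not> blocked a b \<theta> (w k) \<omega>}" for k by auto
    have N_ev: "?N k \<in> events" for k
      unfolding N using ev by (rule sets.sets_Collect_neg)
    have "\<not> blocked a b \<theta> (w k) \<omega>"
      if "becomes_fully_active ?V (tree_edges a b) \<theta> \<omega>" for k \<omega>
    proof -
      obtain t where "active_at (tree_edges a b) \<theta> \<omega> t (w k)"
        using \<open>becomes_fully_active _ _ _ _\<close> w(1) unfolding becomes_fully_active_def by blast
      then show ?thesis using blocked_never_active[OF \<open>2 \<le> \<theta>\<close>] by blast
    qed
    \<comment> \<open>Full activity excludes every blocked node, and by independence
      \<open>n + 1\<close> such exclusions cost a factor of at most \<open>1 - \<delta>\<close>
      each.\<close>
    then have "?F \<subseteq> (\<Inter>k\<in>{..n}. ?N k)" by auto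
    then have "prob ?F \<le> prob (\<Inter>k\<in>{..n}. ?N k)"
      using N_ev by (intro finite_measure_mono sets.finite_INT) auto
    also have "\<dots> = (\<Prod>k\<le>n. prob (?N k))"
      using indep by (rule indep_varsD) auto
    also have "\<dots> \<le> (\<Prod>k\<le>n. 1 - \<delta>)"
      unfolding N using prob_neg[OF ev] \<delta> by (intro prod_mono) auto
    finally show ?thesis by simp
  qed
  have "(\<lambda>n. (1 - \<delta>) ^ n) \<longlonglongrightarrow> 0"
    using \<open>0 < \<delta>\<close> \<open>\<delta> \<le> 1\<close> by (intro LIMSEQ_power_zero) auto
  then have "prob ?F \<le> 0"
    using le by (intro LIMSEQ_le_const[OF LIMSEQ_Suc]) auto
  then show ?thesis
    unfolding fully_active_prob_def using measure_nonneg[of ?M ?F] by linarith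
qed

theorem theorem1:
  fixes a b \<theta> :: nat
  assumes "2 \<le> \<theta>" and "\<theta> < a" and "\<theta> < b"
  shows "\<exists>p\<^sub>f\<in>{0<..<1}.
    (\<forall>p\<in>{0..1}. p\<^sub>f < p \<longrightarrow>
       fully_active_prob (tree_nodes a b) (tree_edges a b) \<theta> p = 1) \<and>
    (\<forall>p\<in>{0..1}. p < p\<^sub>f \<longrightarrow>
       fully_active_prob (tree_nodes a b) (tree_edges a b) \<theta> p = 0)"
proof -
  obtain p\<^sub>f where "p\<^sub>f \<in> {0<..<1}"
    and "\<forall>p\<in>{0..1}. p\<^sub>f < p \<longrightarrow> \<not> survives \<theta> p a b"
    and "\<forall>p\<in>{0..1}. p < p\<^sub>f \<longrightarrow> survives \<theta> p a b"
    using survives_threshold[OF assms] by (elim bexE conjE)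
  then show ?thesis
    using assms by (intro bexI[of _ p\<^sub>f] conjI ballI impI fully_active_prob_eq_1 fully_active_prob_eq_0) auto
qed

end
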